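(* Let $(S_n)_{n\ge 0}$ be a transient random walk in $\mathbb{Z}^d$, $d\ge 1$, and let $f:\mathbb{Z}^+\to\mathbb{R}$ be a function. Let, for some $C<\infty$ and $\varepsilon>0$, (i) either the condition $$\sum_{k=1}^n k\,\mathbb{P}\{S_k=0\}\le C n^{1-\eta}\quad\text{for all } n$$ hold for some $\eta\in(0,1)$ and $|f(i)|\le C e^{i\lambda_*}/i^{2+\varepsilon}$ for all $i$, (ii) or the condition $$\sum_{k=1}^n k\,\mathbb{P}\{S_k=0\}\le C\log n\quad\text{for all } n$$ hold and $|f(i)|\le C e^{i\lambda_*}/(i\log^{2+\varepsilon} i)$ for all $i>0$. Then, with probability $1$, $$\frac{G_n(f)}{n}\ \to\ \gamma^2\sum_{j=1}^\infty f(j)(1-\gamma)^{j-1}\qquad\text{as } n\to\infty .$$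
   Context: $X_1,X_2,\ldots$ are independent identically distributed random vectors with values in $\mathbb{Z}^d$, $d\ge 1$; $S_0:=0$ and $S_n:=X_1+\cdots+X_n$. Put $\gamma:=\mathbb{P}\{S_n\ne 0\text{ for all } n\ge 1\}$; the walk is transient if $\gamma>0$, and it is assumed throughout that also $\gamma<1$. Further, $\lambda_*:=\log\frac{1}{1-\gamma}$, and $\log^{a} i$ means $(\log i)^{a}$. The local time of $x\in\mathbb{Z}^d$ up to time $n$ is $l(n,x):=\sum_{i=0}^n \mathbf{1}\{S_i=x\}$. For a function $f:\mathbb{Z}^+\to\mathbb{R}$, $G_n(f):=\sum_{x\in\mathbb{Z}^d} f(l(n,x))$, where only visited sites are counted, that is, $G_n(f)=\sum_{j\ge 1} f(j)Q_n(j)$ with $Q_n(j)$ the number of sites $x$ such that $l(n,x)=j$. *)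

theory Defs
  imports "HOL-Probability.Probability"
begin

text \<open>The steps are \<open>X 1, X 2, \<dots>\<close>; the value \<open>X 0\<close> is never used.\<close>

definition walk :: "(nat \<Rightarrow> 'a \<Rightarrow> int ^ 'd) \<Rightarrow> nat \<Rightarrow> 'a \<Rightarrow> int ^ 'd" where
  "walk X n \<omega> = (\<Sum>i = 1..n. X i \<omega>)"

definition escape_prob :: "'a measure \<Rightarrow> (nat \<Rightarrow> 'a \<Rightarrow> int ^ 'd) \<Rightarrow> real" where
  "escape_prob M X = \<P>(\<omega> in M. \<forall>n\<ge>1. walk X n \<omega> \<noteq> 0)"

definition transient :: "'a measure \<Rightarrow> (nat \<Rightarrow> 'a \<Rightarrow> int ^ 'd) \<Rightarrow> bool" where
  "transient M X \<longleftrightarrow> escape_prob M X > 0"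

definition lambda_star :: "'a measure \<Rightarrow> (nat \<Rightarrow> 'a \<Rightarrow> int ^ 'd) \<Rightarrow> real" where
  "lambda_star M X = ln (1 / (1 - escape_prob M X))"

definition local_time :: "(nat \<Rightarrow> 'a \<Rightarrow> int ^ 'd) \<Rightarrow> nat \<Rightarrow> int ^ 'd \<Rightarrow> 'a \<Rightarrow> nat" where
  "local_time X n x \<omega> = (\<Sum>i = 0..n. of_bool (walk X i \<omega> = x))"

text \<open>Only visited sites are counted, so the value \<open>f 0\<close> is irrelevant and the sum is finite
  (lemma \<open>finite_visited\<close>).\<close>

definition G :: "(nat \<Rightarrow> 'a \<Rightarrow> int ^ 'd) \<Rightarrow> (nat \<Rightarrow> real) \<Rightarrow> nat \<Rightarrow> 'a \<Rightarrow> real" where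
  "G X f n \<omega> = (\<Sum>x | local_time X n x \<omega> \<ge> 1. f (local_time X n x \<omega>))"

definition Q :: "(nat \<Rightarrow> 'a \<Rightarrow> int ^ 'd) \<Rightarrow> nat \<Rightarrow> nat \<Rightarrow> 'a \<Rightarrow> nat" where
  "Q X n j \<omega> = card {x. local_time X n x \<omega> = j}"

lemma finite_visited: "finite {x. local_time X n x \<omega> \<ge> 1}"
proof (rule finite_subset)
  show "{x. local_time X n x \<omega> \<ge> 1} \<subseteq> (\<lambda>i. walk X i \<omega>) ` {0..n}"
  proof
    fix x assume "x \<in> {x. local_time X n x \<omega> \<ge> 1}"
    then have "local_time X n x \<omega> \<noteq> 0" by simp
    then show "x \<in> (\<lambda>i. walk X i \<omega>) ` {0..n}"
      by (auto simp: local_time_def)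
  qed
qed simp

lemma local_time_le: "local_time X n x \<omega> \<le> n + 1"
proof -
  have "local_time X n x \<omega> \<le> (\<Sum>i = 0..n. 1)"
    unfolding local_time_def by (rule sum_mono) simp
  then show ?thesis by simp
qed

text \<open>The terms with \<open>j > n + 1\<close> vanish by \<open>local_time_le\<close>.\<close>

lemma G_eq_sum_Q: "G X f n \<omega> = (\<Sum>j = 1..n + 1. f j * real (Q X n j \<omega>))"
proof -
  let ?V = "{x. local_time X n x \<omega> \<ge> 1}"
  have "G X f n \<omega> =
    (\<Sum>j = 1..n + 1. \<Sum>x \<in> {x \<in> ?V. local_time X n x \<omega> = j}. f (local_time X n x \<omega>))"
    unfolding G_def using finite_visited[of X n \<omega>] local_time_le[of X n _ \<omega>]
    by (intro sum.group[symmetric]) auto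
  also have "\<dots> = (\<Sum>j = 1..n + 1. f j * real (Q X n j \<omega>))"
  proof (rule sum.cong[OF refl])
    fix j assume "j \<in> {1..n + 1}"
    then have "{x \<in> ?V. local_time X n x \<omega> = j} = {x. local_time X n x \<omega> = j}" by auto
    then show "(\<Sum>x \<in> {x \<in> ?V. local_time X n x \<omega> = j}. f (local_time X n x \<omega>))
        = f j * real (Q X n j \<omega>)"
      by (simp add: Q_def)
  qed
  finally show ?thesis .
qed

end

theory Submission
  imports Defs "HOL-Real_Asymp.Real_Asymp"
begin

text \<open>With \<open>f 0 = 0\<close> and \<open>g m = f m - f (m - 1)\<close>, telescoping over the successive visits to a site gives
  \<open>G\<^sub>n(f) = (\<Sum>i\<le>n. g (R\<^sub>n(i)))\<close>, where \<open>R\<^sub>n(i)\<close> is the number of visits to \<open>S\<^sub>i\<close> during \<open>[i, n]\<close>.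
  Letting the horizon go to infinity, \<open>R\<^sub>n(i)\<close> increases to \<open>R \<circ> T\<^sup>i\<close>, where \<open>T\<close> is the shift of the
  i.i.d. steps and \<open>R\<close>, the total number of visits to the origin, is geometric. The ergodic
  theorem gives the limit \<open>E g(R)\<close>, which is the claimed constant. Replacing \<open>R\<^sub>n(i)\<close> by
  \<open>R \<circ> T\<^sup>i\<close> costs at most \<open>2 H(R \<circ> T\<^sup>i)\<close> with \<open>H m = (\<Sum>k\<le>m. \<bar>f k\<bar>)\<close>, and only if the walk
  comes back to \<open>S\<^sub>i\<close> after time \<open>n\<close>; except for the last \<open>K\<close> indices this forces a return after
  more than \<open>K\<close> steps, so the ergodic theorem and dominated convergence as \<open>K \<rightarrow> \<infinity>\<close> remove the error.\<close>

section \<open>The ergodic theorem for i.i.d. sequences\<close>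

definition shift_seq :: "nat \<Rightarrow> (nat \<Rightarrow> 'b) \<Rightarrow> nat \<Rightarrow> 'b" where
  "shift_seq k x = (\<lambda>n. x (k + n))"

lemma shift_seq_0 [simp]: "shift_seq 0 x = x"
  by (simp add: shift_seq_def)

lemma shift_seq_shift_seq [simp]: "shift_seq j (shift_seq k x) = shift_seq (k + j) x"
  by (simp add: shift_seq_def add.assoc)

lemma shift_seq_comb_seq [simp]: "shift_seq k (comb_seq k x y) = y"
  by (simp add: shift_seq_def comb_seq_def)

context sequence_space
begin

lemma measurable_shift [measurable]: "shift_seq k \<in> measurable S S"
  unfolding shift_seq_def
proof (rule measurable_PiM_single'[where f="\<lambda>n x. x (k + n)"])
  show "(\<lambda>x. x (k + n)) \<in> measurable S M" for n by measurable
qed (auto simp: space_PiM PiE_iff)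

text \<open>\<open>comb_seq k\<close> glues the first \<open>k\<close> entries of one sequence in
  front of an independent second one and maps \<open>S \<Otimes>\<^sub>M S\<close> to
  \<open>S\<close>. Shifting by \<open>k\<close> undoes the gluing and leaves the second component,
  which has law \<open>S\<close>.\<close>

lemma distr_shift: "distr S S (shift_seq k) = S"
proof -
  have "distr S S (shift_seq k) = distr (distr (S \<Otimes>\<^sub>M S) S (\<lambda>(x, y). comb_seq k x y)) S (shift_seq k)"
    by (simp add: PiM_comb_seq)
  also have "\<dots> = distr (S \<Otimes>\<^sub>M S) S snd"
    by (subst distr_distr) (auto simp: comp_def split_beta' measurable_comb_seq intro!: distr_cong)
  also have "\<dots> = S"
    by (rule measure_eqI) (auto simp: emeasure_distr P.emeasure_pair_measure_Times
        P.emeasure_space_1 vimage_snd Times_Int_Times space_pair_measure sets.Int_space_eq2 sets.Int_space_eq1)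
  finally show ?thesis .
qed

lemma integral_shift:
  fixes \<phi> :: "(nat \<Rightarrow> 'a) \<Rightarrow> real"
  assumes [measurable]: "\<phi> \<in> borel_measurable S"
  shows "(\<integral>x. \<phi> (shift_seq k x) \<partial>S) = (\<integral>x. \<phi> x \<partial>S)"
  using integral_distr[of "shift_seq k" S S \<phi>] by (simp add: distr_shift)

lemma integrable_shift:
  fixes \<phi> :: "(nat \<Rightarrow> 'a) \<Rightarrow> real"
  assumes "integrable S \<phi>"
  shows "integrable S (\<lambda>x. \<phi> (shift_seq k x))"
  using integrable_distr[of "shift_seq k" S S \<phi>] assms by (simp add: distr_shift)

lemma AE_shift:
  assumes "AE x in S. P x"
  shows "AE x in S. P (shift_seq k x)"
  by (rule AE_distrD[of "shift_seq k" S S]) (use assms in \<open>simp_all only: distr_shift measurable_shift\<close>)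

text \<open>The last hypothesis makes \<open>A\<close> depend on the first \<open>k\<close>
  coordinates only. For a glued pair, \<open>A\<close> is then decided by the first component and
  the shifted event by the second, so the event pulls back to the rectangle
  \<open>A \<times> B\<close>. This serves as the Markov property at time \<open>k\<close>.\<close>

lemma prob_Int_shift:
  assumes [measurable]: "A \<in> sets S" "B \<in> sets S"
    and A: "\<And>x y. x \<in> space S \<Longrightarrow> y \<in> space S \<Longrightarrow> (\<And>i. i < k \<Longrightarrow> x i = y i) \<Longrightarrow> x \<in> A \<Longrightarrow> y \<in> A"
  shows "P.prob {x \<in> space S. x \<in> A \<and> shift_seq k x \<in> B} = P.prob A * P.prob B"
proof -
  let ?E = "{x \<in> space S. x \<in> A \<and> shift_seq k x \<in> B}"
  have E: "?E \<in> sets S" by measurable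
  have AB: "A \<subseteq> space S" "B \<subseteq> space S"
    using sets.sets_into_space assms(1,2) by blast+
  have *: "comb_seq k x y \<in> A \<longleftrightarrow> x \<in> A" "comb_seq k x y \<in> space S"
    if "x \<in> space S" "y \<in> space S" for x y
  proof -
    show **: "comb_seq k x y \<in> space S"
      using that by (auto simp: space_PiM PiE_iff split: split_comb_seq)
    show "comb_seq k x y \<in> A \<longleftrightarrow> x \<in> A"
      using A[OF that(1) **] A[OF ** that(1)] by (auto simp: comb_seq_less)
  qed
  have "emeasure S ?E = emeasure (distr (S \<Otimes>\<^sub>M S) S (\<lambda>(x, y). comb_seq k x y)) ?E"
    by (simp add: PiM_comb_seq)
  also have "\<dots> = emeasure (S \<Otimes>\<^sub>M S) (A \<times> B)"
  proof (subst emeasure_distr[OF measurable_comb_seq E], rule arg_cong[where f="emeasure _"])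
    show "(\<lambda>(x, y). comb_seq k x y) -` ?E \<inter> space (S \<Otimes>\<^sub>M S) = A \<times> B"
      unfolding space_pair_measure using AB
      by (auto simp: * subset_iff simp del: space_PiM)
  qed
  also have "\<dots> = emeasure S A * emeasure S B"
    by (rule P.emeasure_pair_measure_Times) auto
  finally show ?thesis
    by (simp add: P.emeasure_eq_measure flip: ennreal_mult')
qed

text \<open>An invariant event is its own preimage under every \<open>shift_seq n\<close>, hence
  determined by the coordinates from \<open>n\<close> on. It is therefore a tail event, and
  Kolmogorov's law applies.\<close>

lemma shift_invariant_0_1:
  assumes A: "A \<in> sets S"
    and inv: "\<And>x. x \<in> space S \<Longrightarrow> shift_seq 1 x \<in> A \<longleftrightarrow> x \<in> A"
  shows "P.prob A = 0 \<or> P.prob A = 1"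
proof -
  let ?F = "\<lambda>i. {(\<lambda>x. x i) -` B \<inter> space S |B. B \<in> sets M}"
  have inv': "shift_seq k x \<in> A \<longleftrightarrow> x \<in> A" if "x \<in> space S" for k x
    using that
  proof (induction k)
    case (Suc k)
    then have "shift_seq k x \<in> space S"
      using measurable_space[OF measurable_shift] by blast
    from inv[OF this] Suc show ?case by simp
  qed simp
  show ?thesis
  proof (rule P.kolmogorov_0_1_law)
    show "sigma_algebra (space S) (?F i)" for i
      using sets.sigma_algebra_axioms[of "vimage_algebra (space S) (\<lambda>x. x i) M"]
      by (subst (asm) sets_vimage_algebra2) (auto simp: space_PiM PiE_iff)
    have "P.indep_vars (\<lambda>_. M) (\<lambda>i x. x i) UNIV"
      by (subst P.indep_vars_iff_distr_eq_PiM)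
         (auto simp: PiM_component restrict_UNIV distr_id2)
    then show "P.indep_sets ?F UNIV"
      by (simp add: P.indep_vars_def2)
    show "A \<in> P.tail_events ?F"
      unfolding P.tail_events_def
    proof
      fix n :: nat
      let ?N = "sigma (space S) (\<Union> (?F ` {n..}))"
      have sub: "\<Union> (?F ` {n..}) \<subseteq> Pow (space S)" by auto
      \<comment> \<open>\<open>?N\<close> is generated by the coordinates from \<open>n\<close> on,
        and these are all that \<open>shift_seq n\<close> reads.\<close>
      have "shift_seq n \<in> measurable ?N S"
      proof (rule measurable_PiM_single')
        fix i
        show "(\<lambda>x. shift_seq n x i) \<in> measurable ?N M"
        proof (rule measurableI)
          fix x assume "x \<in> space ?N"
          then show "shift_seq n x i \<in> space M"
            using sub by (auto simp: space_measure_of_conv shift_seq_def space_PiM PiE_iff)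
        next
          fix B assume "B \<in> sets M"
          then have "(\<lambda>x. x (n + i)) -` B \<inter> space S \<in> sigma_sets (space S) (\<Union> (?F ` {n..}))"
            by (intro sigma_sets.Basic) (auto intro!: bexI[of _ "n + i"])
          then show "(\<lambda>x. shift_seq n x i) -` B \<inter> space ?N \<in> sets ?N"
            using sub by (simp add: space_measure_of_conv sets_measure_of shift_seq_def)
        qed
      qed (auto simp: space_measure_of_conv shift_seq_def space_PiM PiE_iff)
      from measurable_sets[OF this A]
      have "shift_seq n -` A \<inter> space S \<in> sigma_sets (space S) (\<Union> (?F ` {n..}))"
        using sub by (simp add: space_measure_of_conv sets_measure_of)
      also have "shift_seq n -` A \<inter> space S = A"
        using inv' sets.sets_into_space[OF A] by auto
      finally show "A \<in> sigma_sets (space S) (\<Union> (?F ` {n..}))" .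
    qed
  qed
qed

section \<open>Birkhoff sums, their running maxima, and the ergodic theorem\<close>

definition birkhoff_sum :: "((nat \<Rightarrow> 'a) \<Rightarrow> real) \<Rightarrow> nat \<Rightarrow> (nat \<Rightarrow> 'a) \<Rightarrow> real" where
  "birkhoff_sum \<phi> n x = (\<Sum>i<n. \<phi> (shift_seq i x))"

text \<open>This is the maximum of \<open>birkhoff_sum \<phi> k x\<close> over
  \<open>k \<le> n\<close>, with the empty sum included. The recursive form relates it directly to
  its own shift, which is what the comparison of integrals exploits.\<close>

primrec birkhoff_max :: "((nat \<Rightarrow> 'a) \<Rightarrow> real) \<Rightarrow> nat \<Rightarrow> (nat \<Rightarrow> 'a) \<Rightarrow> real" where
  "birkhoff_max \<phi> 0 x = 0"
| "birkhoff_max \<phi> (Suc n) x = max 0 (\<phi> x + birkhoff_max \<phi> n (shift_seq 1 x))"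

lemma birkhoff_sum_0 [simp]: "birkhoff_sum \<phi> 0 x = 0"
  by (simp add: birkhoff_sum_def)

lemma birkhoff_sum_Suc: "birkhoff_sum \<phi> (Suc n) x = \<phi> x + birkhoff_sum \<phi> n (shift_seq 1 x)"
  by (simp add: birkhoff_sum_def sum.lessThan_Suc_shift del: sum.lessThan_Suc)

lemma measurable_birkhoff_sum [measurable (raw)]:
  assumes [measurable]: "\<phi> \<in> borel_measurable S"
  shows "birkhoff_sum \<phi> n \<in> borel_measurable S"
  unfolding birkhoff_sum_def by measurable

lemma birkhoff_max_nonneg: "0 \<le> birkhoff_max \<phi> n x"
  by (cases n) auto

lemma integrable_birkhoff_max:
  assumes "integrable S \<phi>"
  shows "integrable S (birkhoff_max \<phi> n)"
proof (induction n)
  case (Suc n)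
  from integrable_shift[OF Suc] assms show ?case
    by (auto intro!: integrable_max)
qed auto

lemma birkhoff_max_mono: "birkhoff_max \<phi> n x \<le> birkhoff_max \<phi> (Suc n) x"
proof (induction n arbitrary: x)
  case (Suc n)
  from Suc[of "shift_seq 1 x"] show ?case by auto
qed simp

lemma birkhoff_sum_le_max: "k \<le> n \<Longrightarrow> birkhoff_sum \<phi> k x \<le> birkhoff_max \<phi> n x"
proof (induction n arbitrary: k x)
  case (Suc n)
  show ?case
  proof (cases k)
    case (Suc l)
    with Suc.IH[of l "shift_seq 1 x"] Suc.prems show ?thesis
      by (auto simp: birkhoff_sum_Suc max_def)
  qed (simp add: birkhoff_max_nonneg del: birkhoff_max.simps)
qed simp

text \<open>If the Birkhoff sums were unbounded almost surely, then
  \<open>birkhoff_max \<phi> (n + 1) - birkhoff_max \<phi> n \<circ> T = max (- birkhoff_max \<phi> n \<circ> T) \<phi>\<close> would tend to \<open>\<phi>\<close>;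
  its integral is nonnegative because \<open>T\<close> preserves the measure.\<close>

lemma AE_birkhoff_sum_bdd_above:
  assumes int: "integrable S \<phi>" and neg: "(\<integral>x. \<phi> x \<partial>S) < 0"
  shows "AE x in S. \<exists>m::nat. \<forall>n. birkhoff_sum \<phi> n x \<le> real m"
proof -
  have [measurable]: "\<phi> \<in> borel_measurable S" using int by simp
  \<comment> \<open>The bounds \<open>m\<close> range over \<open>nat\<close>, so \<open>A\<close>
    is a countable combination of measurable sets.\<close>
  define A where "A = {x \<in> space S. \<forall>m::nat. \<exists>n. birkhoff_sum \<phi> n x > real m}"
  have A [measurable]: "A \<in> sets S"
    unfolding A_def by measurable
  have inv: "shift_seq 1 x \<in> A \<longleftrightarrow> x \<in> A" if x: "x \<in> space S" for x
  proof
    assume *: "shift_seq 1 x \<in> A"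
    have "\<exists>n. birkhoff_sum \<phi> n x > real m" for m
    proof -
      \<comment> \<open>Sums along \<open>x\<close> and along the shifted sequence differ by the
        single term \<open>\<phi> x\<close>; the surplus
        \<open>nat \<lceil>\<bar>\<phi> x\<bar>\<rceil>\<close> absorbs it, here and in the converse
        direction.\<close>
      obtain n where "birkhoff_sum \<phi> n (shift_seq 1 x) > real (m + nat \<lceil>\<bar>\<phi> x\<bar>\<rceil>)"
        using * by (auto simp only: A_def mem_Collect_eq)
      then have "birkhoff_sum \<phi> (Suc n) x > real m"
        unfolding birkhoff_sum_Suc by linarith
      then show ?thesis by blast
    qed
    with x show "x \<in> A" by (simp add: A_def)
  next
    assume *: "x \<in> A"
    have "\<exists>n. birkhoff_sum \<phi> n (shift_seq 1 x) > real m" for m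
    proof -
      obtain n where n: "birkhoff_sum \<phi> n x > real (m + nat \<lceil>\<bar>\<phi> x\<bar>\<rceil>)"
        using * by (auto simp only: A_def mem_Collect_eq)
      then have "n \<noteq> 0" by (intro notI) (simp, linarith)
      then obtain k where "n = Suc k" by (cases n) auto
      with n have "birkhoff_sum \<phi> (Suc k) x > real (m + nat \<lceil>\<bar>\<phi> x\<bar>\<rceil>)" by simp
      then have "birkhoff_sum \<phi> k (shift_seq 1 x) > real m"
        unfolding birkhoff_sum_Suc by linarith
      then show ?thesis by blast
    qed
    moreover have "shift_seq 1 x \<in> space S"
      using x measurable_space[OF measurable_shift] by blast
    ultimately show "shift_seq 1 x \<in> A" by (simp add: A_def)
  qed
  have "P.prob A \<noteq> 1"
  proof
    assume "P.prob A = 1"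
    then have AE: "AE x in S. x \<in> A"
      using P.prob_eq_1[OF A] by simp
    let ?d = "\<lambda>n x. birkhoff_max \<phi> (Suc n) x - birkhoff_max \<phi> n (shift_seq 1 x)"
    have lim: "(\<lambda>n. \<integral>x. ?d n x \<partial>S) \<longlonglongrightarrow> (\<integral>x. \<phi> x \<partial>S)"
    proof (rule integral_dominated_convergence)
      show "integrable S (\<lambda>x. \<bar>\<phi> x\<bar>)" using int by simp
      show "?d n \<in> borel_measurable S" for n
        using integrable_birkhoff_max[OF int] integrable_shift[OF integrable_birkhoff_max[OF int]]
        by (intro borel_measurable_diff) (blast intro: borel_measurable_integrable)+
      \<comment> \<open>Either \<open>?d n x\<close> equals \<open>\<phi> x\<close>, or it is minus
        the shifted maximum, which then lies between \<open>\<phi> x\<close> and 0.\<close>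
      show "AE x in S. norm (?d n x) \<le> \<bar>\<phi> x\<bar>" for n
      proof (rule AE_I2)
        fix x
        show "norm (?d n x) \<le> \<bar>\<phi> x\<bar>"
          using birkhoff_max_nonneg[of \<phi> n "shift_seq 1 x"] by (simp add: max_def abs_if)
      qed
      show "AE x in S. (\<lambda>n. ?d n x) \<longlonglongrightarrow> \<phi> x"
        using AE AE_space
      proof eventually_elim
        case (elim x)
        then have "shift_seq 1 x \<in> A" using inv by blast
        then obtain k where k: "birkhoff_sum \<phi> k (shift_seq 1 x) > real (nat \<lceil>\<bar>\<phi> x\<bar>\<rceil>)"
          by (auto simp only: A_def mem_Collect_eq)
        have "eventually (\<lambda>n. ?d n x = \<phi> x) sequentially"
          using eventually_ge_at_top[of k]
        proof eventually_elim
          case (elim n)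
          from birkhoff_sum_le_max[OF this, of \<phi> "shift_seq 1 x"] k
          have "birkhoff_max \<phi> n (shift_seq 1 x) \<ge> \<bar>\<phi> x\<bar>" by linarith
          then show ?case by (auto simp: max_def)
        qed
        then show ?case by (rule tendsto_eventually)
      qed
    qed simp
    have "(\<integral>x. ?d n x \<partial>S) \<ge> 0" for n
    proof -
      have "(\<integral>x. ?d n x \<partial>S)
          = (\<integral>x. birkhoff_max \<phi> (Suc n) x \<partial>S) - (\<integral>x. birkhoff_max \<phi> n (shift_seq 1 x) \<partial>S)"
        by (intro Bochner_Integration.integral_diff integrable_birkhoff_max
            integrable_shift int)
      moreover have "(\<integral>x. birkhoff_max \<phi> n (shift_seq 1 x) \<partial>S) = (\<integral>x. birkhoff_max \<phi> n x \<partial>S)"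
        by (intro integral_shift borel_measurable_integrable integrable_birkhoff_max int)
      moreover have "(\<integral>x. birkhoff_max \<phi> n x \<partial>S) \<le> (\<integral>x. birkhoff_max \<phi> (Suc n) x \<partial>S)"
        by (intro integral_mono integrable_birkhoff_max int birkhoff_max_mono)
      ultimately show ?thesis by (simp del: birkhoff_max.simps)
    qed
    then have "(\<integral>x. \<phi> x \<partial>S) \<ge> 0"
      by (intro LIMSEQ_le_const[OF lim]) blast
    with neg show False by simp
  qed
  then have "P.prob A = 0"
    using shift_invariant_0_1[OF A inv] by blast
  then have "AE x in S. x \<notin> A"
    using P.prob_eq_0[OF A] by simp
  then show ?thesis
    using AE_space by eventually_elim (auto simp: A_def not_less)
qed

text \<open>With \<open>c'\<close> halfway between the mean and \<open>c\<close>, the function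
  \<open>\<phi> - c'\<close> has negative mean, so its sums stay below some \<open>m\<close>. The
  averages of \<open>\<phi>\<close> are then at most \<open>c' + m / n\<close>, eventually less than
  \<open>c\<close>.\<close>

lemma AE_birkhoff_average_upper:
  assumes int: "integrable S \<phi>" and "(\<integral>x. \<phi> x \<partial>S) < c"
  shows "AE x in S. \<forall>\<^sub>F n in sequentially. birkhoff_sum \<phi> n x / real n < c"
proof -
  define c' where "c' = ((\<integral>x. \<phi> x \<partial>S) + c) / 2"
  have c': "(\<integral>x. \<phi> x \<partial>S) < c'" "c' < c"
    using assms(2) by (auto simp: c'_def)
  let ?\<psi> = "\<lambda>x. \<phi> x - c'"
  have "AE x in S. \<exists>m::nat. \<forall>n. birkhoff_sum ?\<psi> n x \<le> real m"
    using int c' by (intro AE_birkhoff_sum_bdd_above) (auto simp: P.prob_space)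
  then show ?thesis
  proof eventually_elim
    case (elim x)
    then obtain m :: nat where m: "birkhoff_sum ?\<psi> n x \<le> real m" for n by blast
    have "filterlim (\<lambda>n. (c - c') * real n) at_top sequentially"
      using c' by (intro filterlim_tendsto_pos_mult_at_top[OF tendsto_const] filterlim_real_sequentially) auto
    then have "\<forall>\<^sub>F n in sequentially. (c - c') * real n > real m"
      by (rule filterlim_at_top_dense[THEN iffD1, rule_format])
    then show ?case
      using eventually_gt_at_top[of 0]
    proof eventually_elim
      case (elim n)
      have "birkhoff_sum \<phi> n x - real n * c' \<le> real m"
        using m[of n] by (simp add: birkhoff_sum_def sum_subtractf)
      with elim have "birkhoff_sum \<phi> n x < c * real n"
        by (simp add: algebra_simps)
      with elim show ?case by (simp add: divide_less_eq)
    qed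
  qed
qed

text \<open>The one-sided bound is applied to \<open>\<phi>\<close> and to \<open>- \<phi>\<close>
  with the countably many margins \<open>1 / Suc k\<close>, so that the exceptional null sets can be
  united.\<close>

theorem birkhoff:
  assumes int: "integrable S \<phi>"
  shows "AE x in S. (\<lambda>n. birkhoff_sum \<phi> n x / real n) \<longlonglongrightarrow> (\<integral>x. \<phi> x \<partial>S)"
proof -
  let ?I = "\<integral>x. \<phi> x \<partial>S"
  have "AE x in S. \<forall>k::nat. \<forall>\<^sub>F n in sequentially. birkhoff_sum \<phi> n x / real n < ?I + 1 / Suc k"
    using int by (subst AE_all_countable) (auto intro!: AE_birkhoff_average_upper)
  moreover have "AE x in S. \<forall>k::nat. \<forall>\<^sub>F n in sequentially.
      birkhoff_sum (\<lambda>x. - \<phi> x) n x / real n < - ?I + 1 / Suc k"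
    using int by (subst AE_all_countable) (auto intro!: AE_birkhoff_average_upper)
  ultimately show ?thesis
  proof eventually_elim
    case (elim x)
    show ?case
    proof (rule LIMSEQ_I)
      fix r :: real assume "r > 0"
      then obtain k where k: "1 / real (Suc k) < r"
        using reals_Archimedean by (auto simp: inverse_eq_divide)
      have "\<forall>\<^sub>F n in sequentially. norm (birkhoff_sum \<phi> n x / real n - ?I) < r"
        using elim(1)[rule_format, of k] elim(2)[rule_format, of k]
      proof eventually_elim
        case (elim n)
        then show ?case
          using k by (auto simp: birkhoff_sum_def sum_negf abs_less_iff)
      qed
      then show "\<exists>no. \<forall>n\<ge>no. norm (birkhoff_sum \<phi> n x / real n - ?I) < r"
        by (simp add: eventually_sequentially)
    qed
  qed
qed

end

section \<open>The law of the number of visits\<close>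

definition partial_sum :: "nat \<Rightarrow> (nat \<Rightarrow> int ^ 'd) \<Rightarrow> int ^ 'd" where
  "partial_sum n x = (\<Sum>i<n. x i)"

text \<open>Time 0 is counted, so the value is at least 1. The quantity \<open>R\<^sub>n(i)\<close>
  is \<open>visits (n - i) (shift_seq i x)\<close>.\<close>

definition visits :: "nat \<Rightarrow> (nat \<Rightarrow> int ^ 'd) \<Rightarrow> nat" where
  "visits n x = card {j. j \<le> n \<and> partial_sum j x = 0}"

text \<open>Junk value 0 when there are infinitely many visits.\<close>

definition total_visits :: "(nat \<Rightarrow> int ^ 'd) \<Rightarrow> nat" where
  "total_visits x = card {j. partial_sum j x = 0}"

lemma partial_sum_0 [simp]: "partial_sum 0 x = 0"
  by (simp add: partial_sum_def)

lemma partial_sum_shift: "partial_sum n (shift_seq k x) = partial_sum (k + n) x - partial_sum k x"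
  by (induction n) (simp_all add: partial_sum_def shift_seq_def algebra_simps)

lemma visits_le_total:
  "finite {j. partial_sum j x = 0} \<Longrightarrow> visits n x \<le> total_visits x"
  unfolding visits_def total_visits_def by (intro card_mono) auto

lemma visits_eq_total:
  assumes "\<And>j. j > n \<Longrightarrow> partial_sum j x \<noteq> 0"
  shows "visits n x = total_visits x"
  unfolding visits_def total_visits_def using assms
  by (intro arg_cong[where f=card]) (auto simp: not_less[symmetric])

text \<open>Before the first return time \<open>k\<close> only time 0 is a visit; the visits from
  \<open>k\<close> on are those of the restarted walk, translated by \<open>k\<close>.\<close>

lemma visits_first_return:
  assumes "k > 0" "k \<le> n" "partial_sum k x = 0" "\<And>j. 0 < j \<Longrightarrow> j < k \<Longrightarrow> partial_sum j x \<noteq> 0"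
  shows "visits n x = Suc (visits (n - k) (shift_seq k x))"
proof -
  let ?B = "{j. j \<le> n - k \<and> partial_sum j (shift_seq k x) = 0}"
  have "{j. j \<le> n \<and> partial_sum j x = 0} = insert 0 ((+) k ` ?B)"
  proof (rule Set.set_eqI)
    fix j
    consider "j = 0" | "0 < j" "j < k" | i where "j = k + i"
      by (metis le_add_diff_inverse not_gr_zero not_less)
    then show "j \<in> {j. j \<le> n \<and> partial_sum j x = 0} \<longleftrightarrow> j \<in> insert 0 ((+) k ` ?B)"
      by cases (use assms in \<open>auto simp: partial_sum_shift image_iff\<close>)
  qed
  moreover have "0 \<notin> (+) k ` ?B" using assms(1) by auto
  ultimately show ?thesis
    unfolding visits_def by (simp add: card_image)
qed

text \<open>As \<open>i\<close> descends through \<open>A\<close>, the cardinalities run through 1,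
  2, ..., \<open>card A\<close>, and the sum telescopes. Inserting a new minimum adds the top term
  and leaves the other upper sets unchanged.\<close>

lemma sum_diff_card_upper:
  fixes f :: "nat \<Rightarrow> real" and A :: "nat set"
  assumes "finite A" "f 0 = 0"
  shows "(\<Sum>i\<in>A. f (card {j\<in>A. i \<le> j}) - f (card {j\<in>A. i \<le> j} - 1)) = f (card A)"
  using assms(1)
proof (induction A rule: finite_linorder_min_induct)
  case (insert b A)
  have "b \<notin> A" using insert by auto
  have "{j \<in> insert b A. b \<le> j} = insert b A"
    using insert by auto
  moreover have "{j \<in> insert b A. i \<le> j} = {j \<in> A. i \<le> j}" if "i \<in> A" for i
    using insert that by auto
  ultimately show ?case
    using insert \<open>b \<notin> A\<close> by simp
qed (simp add: assms)

text \<open>The times up to \<open>n\<close> are grouped by position. Within a group,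
  \<open>visits (n - i) (shift_seq i x)\<close> counts the members from \<open>i\<close> on, so
  \<open>sum_diff_card_upper\<close> evaluates the group.\<close>

lemma sum_local_times_eq:
  fixes f :: "nat \<Rightarrow> real" and x :: "nat \<Rightarrow> int ^ 'd"
  assumes "f 0 = 0"
  shows "(\<Sum>y\<in>(\<lambda>i. partial_sum i x) ` {..n}. f (card {i. i \<le> n \<and> partial_sum i x = y}))
    = (\<Sum>i\<le>n. f (visits (n - i) (shift_seq i x)) - f (visits (n - i) (shift_seq i x) - 1))"
proof -
  have *: "visits (n - i) (shift_seq i x) = card {j \<in> {k \<in> {..n}. partial_sum k x = partial_sum i x}. i \<le> j}"
    if "i \<le> n" for i
  proof -
    have "{j \<in> {k \<in> {..n}. partial_sum k x = partial_sum i x}. i \<le> j}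
        = (+) i ` {j. j \<le> n - i \<and> partial_sum j (shift_seq i x) = 0}"
    proof (rule Set.set_eqI)
      fix j
      consider "j < i" | k where "j = i + k"
        by (metis le_add_diff_inverse not_less)
      then show "j \<in> {j \<in> {k \<in> {..n}. partial_sum k x = partial_sum i x}. i \<le> j} \<longleftrightarrow>
          j \<in> (+) i ` {j. j \<le> n - i \<and> partial_sum j (shift_seq i x) = 0}"
        by cases (use that in \<open>auto simp: partial_sum_shift image_iff\<close>)
    qed
    then show ?thesis
      by (simp add: visits_def card_image)
  qed
  let ?t = "\<lambda>i. f (visits (n - i) (shift_seq i x)) - f (visits (n - i) (shift_seq i x) - 1)"
  have "(\<Sum>i\<le>n. ?t i)
      = (\<Sum>y\<in>(\<lambda>i. partial_sum i x) ` {..n}. \<Sum>i\<in>{i \<in> {..n}. partial_sum i x = y}. ?t i)"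
    by (rule sum.group[symmetric]) auto
  also have "\<dots> = (\<Sum>y\<in>(\<lambda>i. partial_sum i x) ` {..n}. f (card {i. i \<le> n \<and> partial_sum i x = y}))"
  proof (rule sum.cong[OF refl])
    fix y
    let ?A = "{i \<in> {..n}. partial_sum i x = y}"
    have "(\<Sum>i\<in>?A. ?t i)
        = (\<Sum>i\<in>?A. f (card {j\<in>?A. i \<le> j}) - f (card {j\<in>?A. i \<le> j} - 1))"
      by (intro sum.cong refl) (auto simp: *)
    also have "\<dots> = f (card ?A)"
      by (intro sum_diff_card_upper assms) auto
    finally show "(\<Sum>i\<in>?A. ?t i) = f (card {i. i \<le> n \<and> partial_sum i x = y})"
      by simp
  qed
  finally show ?thesis ..
qed

text \<open>Without a return after \<open>n\<close> both counts agree. Otherwise each of the two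
  values of \<open>g\<close> is bounded by \<open>H\<close> at its argument, and \<open>H\<close> is
  monotone; this gives the factor 2.\<close>

lemma abs_diff_visits_le:
  fixes f :: "nat \<Rightarrow> real"
  assumes fin: "finite {j. partial_sum j x = 0}"
  defines "g \<equiv> \<lambda>m. f m - f (m - 1)" and "H \<equiv> \<lambda>m. \<Sum>k\<le>m. \<bar>f k\<bar>"
  shows "\<bar>g (visits n x) - g (total_visits x)\<bar>
    \<le> 2 * (H (total_visits x) * of_bool (\<exists>j>n. partial_sum j x = 0))"
proof -
  have g: "\<bar>g m\<bar> \<le> H m" for m
  proof (cases m)
    case (Suc l)
    have "\<bar>f (Suc l) - f l\<bar> \<le> \<bar>f (Suc l)\<bar> + \<bar>f l\<bar>" by linarith
    also have "\<dots> \<le> H (Suc l)"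
      by (cases l) (auto simp: H_def sum_nonneg)
    finally show ?thesis by (simp add: g_def Suc)
  qed (simp add: g_def H_def)
  have H: "H (visits n x) \<le> H (total_visits x)" "0 \<le> H (total_visits x)"
    unfolding H_def using visits_le_total[OF fin] by (auto intro!: sum_mono2 sum_nonneg)
  show ?thesis
  proof (cases "\<exists>j>n. partial_sum j x = 0")
    case True
    then show ?thesis
      using g[of "visits n x"] g[of "total_visits x"] H
        abs_triangle_ineq4[of "g (visits n x)" "g (total_visits x)"] by simp
  next
    case False
    then have "visits n x = total_visits x"
      by (intro visits_eq_total) auto
    then show ?thesis using H by auto
  qed
qed

section \<open>The geometric law of the total number of visits\<close>

locale iid_steps = sequence_space M for M :: "(int ^ 'd) measure" +
  assumes sets_M [measurable_cong]: "sets M = sets (count_space UNIV)"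
begin

lemma space_S: "space S = UNIV"
  using sets_eq_imp_space_eq[OF sets_M] by (simp add: space_PiM PiE_UNIV_domain)

lemma measurable_partial_sum [measurable]: "partial_sum n \<in> measurable S (count_space UNIV)"
proof (induction n)
  case 0
  then show ?case by (simp add: partial_sum_def)
next
  case (Suc n)
  have "(\<lambda>x. x n + y) \<in> measurable S (count_space UNIV)" for y
    by (rule measurable_compose[of "\<lambda>x. x n" S M])
       (auto simp: measurable_cong_sets[OF sets_M refl])
  from measurable_compose_countable[OF this Suc] show ?case
    by (simp add: partial_sum_def add.commute)
qed

lemma measurable_total_visits [measurable]: "total_visits \<in> measurable S (count_space UNIV)"
  unfolding total_visits_def by measurable

lemma sets_total_visits: "{x. P (total_visits x)} \<in> sets S"
  using measurable_sets[OF measurable_total_visits, of "Collect P"]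
  by (simp add: space_S vimage_def)

lemma measurable_visits [measurable]: "visits n \<in> measurable S (count_space UNIV)"
  unfolding visits_def by measurable

text \<open>This plays the role of \<open>1 - \<gamma>\<close> on the canonical product
  space.\<close>

definition return_prob :: real where
  "return_prob = P.prob {x. \<exists>n\<ge>1. partial_sum n x = 0}"

lemma return_prob_nonneg: "0 \<le> return_prob"
  by (simp add: return_prob_def)

lemma pred_eq_sets: "Measurable.pred S P \<Longrightarrow> {x. P x} \<in> sets S"
  by (simp add: pred_def space_S)

text \<open>Decomposition at the first return: after it the restarted walk is independent of the
  past and must make one visit fewer, so each step of the induction contributes a factor
  \<open>return_prob\<close>. Stating the event through \<open>visits\<close> instead of
  \<open>total_visits\<close> keeps it meaningful for infinitely many visits.\<close>

lemma prob_visits_Suc: "P.prob {x. \<exists>n. visits n x \<ge> Suc m} = return_prob ^ m"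
proof (induction m)
  case 0
  have "visits 0 x = 1" for x :: "nat \<Rightarrow> int ^ 'd"
    by (simp add: visits_def cong: conj_cong)
  then have "{x :: nat \<Rightarrow> int ^ 'd. \<exists>n. visits n x \<ge> Suc 0} = UNIV" 
    by (metis (mono_tags, lifting) One_nat_def UNIV_eq_I mem_Collect_eq order_refl)
  then show ?case using P.prob_space by (simp add: space_S)
next
  case (Suc m)
  let ?E = "\<lambda>m. {x. \<exists>n. visits n x \<ge> Suc m}"
  \<comment> \<open>The first return happens exactly at time \<open>Suc k\<close>, an event
    determined by the first \<open>Suc k\<close> steps.\<close>
  let ?F = "\<lambda>k. {x. partial_sum (Suc k) x = 0 \<and> (\<forall>j\<in>{1..k}. partial_sum j x \<noteq> 0)}"
  have E: "?E m \<in> sets S" for m by (rule pred_eq_sets) measurable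
  have F: "?F k \<in> sets S" for k by (rule pred_eq_sets) measurable
  have FE: "{x. x \<in> ?F k \<and> shift_seq (Suc k) x \<in> ?E m} \<in> sets S" for k
    by (rule pred_eq_sets) (use E F in measurable)
  have first: "\<exists>k. x \<in> ?F k \<and> k < n" if "partial_sum n x = 0" "n \<ge> 1" for n x
  proof -
    define k where "k = (LEAST k. partial_sum (Suc k) x = 0)"
    from that obtain l where l: "n = Suc l" by (cases n) auto
    with that have *: "partial_sum (Suc l) x = 0" by simp
    have "partial_sum (Suc k) x = 0"
      unfolding k_def by (rule LeastI) (rule *)
    moreover have "k \<le> l" unfolding k_def by (rule Least_le) (rule *)
    moreover have "partial_sum j x \<noteq> 0" if "j \<in> {1..k}" for j
    proof -
      have "j - 1 < k" using that by auto
      then have "partial_sum (Suc (j - 1)) x \<noteq> 0" unfolding k_def by (rule not_less_Least)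
      with that show ?thesis by simp
    qed
    ultimately show ?thesis using l by auto
  qed
  have uniq: "k = k'" if "x \<in> ?F k" "x \<in> ?F k'" for k k' x
    using that by (cases k k' rule: linorder_cases) auto
  have "(\<lambda>k. P.prob (?F k)) sums P.prob (\<Union>k. ?F k)"
    using F uniq by (intro P.finite_measure_UNION) (auto simp: disjoint_family_on_def)
  also have "(\<Union>k. ?F k) = {x. \<exists>n\<ge>1. partial_sum n x = 0}"
    using first by (fastforce intro: exI[of _ "Suc _"])
  finally have s1: "(\<lambda>k. P.prob (?F k)) sums return_prob"
    by (simp add: return_prob_def)
  have "(\<lambda>k. P.prob {x. x \<in> ?F k \<and> shift_seq (Suc k) x \<in> ?E m})
      sums P.prob (\<Union>k. {x. x \<in> ?F k \<and> shift_seq (Suc k) x \<in> ?E m})"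
    using FE uniq by (intro P.finite_measure_UNION) (auto simp: disjoint_family_on_def)
  also have "(\<Union>k. {x. x \<in> ?F k \<and> shift_seq (Suc k) x \<in> ?E m}) = ?E (Suc m)"
  proof (intro Set.equalityI subsetI)
    fix x assume "x \<in> (\<Union>k. {x. x \<in> ?F k \<and> shift_seq (Suc k) x \<in> ?E m})"
    then obtain k n where "x \<in> ?F k" "visits n (shift_seq (Suc k) x) \<ge> Suc m"
      by blast
    then have "visits (n + Suc k) x \<ge> Suc (Suc m)"
      by (subst visits_first_return[of "Suc k"]) auto
    then show "x \<in> ?E (Suc m)" by blast
  next
    fix x assume "x \<in> ?E (Suc m)"
    then obtain n where n: "visits n x \<ge> Suc (Suc m)" by blast
    \<comment> \<open>Of the at least two visits, only one can be at time 0.\<close>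
    have "\<exists>j. j \<ge> 1 \<and> j \<le> n \<and> partial_sum j x = 0"
    proof (rule ccontr)
      assume "\<not> ?thesis"
      then have "{j. j \<le> n \<and> partial_sum j x = 0} \<subseteq> {0}"
        by (auto simp: not_less_eq_eq)
      from card_mono[OF _ this] have "visits n x \<le> 1" by (simp add: visits_def)
      with n show False by simp
    qed
    then obtain j where "j \<ge> 1" "j \<le> n" "partial_sum j x = 0" by blast
    with first[of j x] obtain k where k: "x \<in> ?F k" "k < n" by (auto intro: less_le_trans)
    then have "visits n x = Suc (visits (n - Suc k) (shift_seq (Suc k) x))"
      by (intro visits_first_return) auto
    with n have "shift_seq (Suc k) x \<in> ?E m" by auto
    with k show "x \<in> (\<Union>k. {x. x \<in> ?F k \<and> shift_seq (Suc k) x \<in> ?E m})" by blast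
  qed
  also have "(\<lambda>k. P.prob {x. x \<in> ?F k \<and> shift_seq (Suc k) x \<in> ?E m})
      = (\<lambda>k. P.prob (?F k) * P.prob (?E m))"
  proof
    fix k
    have *: "y \<in> ?F k" if "\<And>i. i < Suc k \<Longrightarrow> x i = y i" "x \<in> ?F k" for x y
    proof -
      have "partial_sum j y = partial_sum j x" if "j \<le> Suc k" for j
        unfolding partial_sum_def using that \<open>\<And>i. i < Suc k \<Longrightarrow> x i = y i\<close>
        by (intro sum.cong) auto
      with that(2) show ?thesis by simp
    qed
    have "P.prob {x \<in> space S. x \<in> ?F k \<and> shift_seq (Suc k) x \<in> ?E m}
        = P.prob (?F k) * P.prob (?E m)"
      by (rule prob_Int_shift[OF F E]) (rule *)
    then show "P.prob {x. x \<in> ?F k \<and> shift_seq (Suc k) x \<in> ?E m} = P.prob (?F k) * P.prob (?E m)"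
      by (simp add: space_S)
  qed
  finally have "(\<lambda>k. P.prob (?F k) * P.prob (?E m)) sums P.prob (?E (Suc m))" .
  from sums_unique2[OF this sums_mult2[OF s1]] show ?case
    by (simp only: Suc power_Suc)
qed

lemma visits_ge_iff_total_visits_ge:
  assumes "finite {j. partial_sum j x = 0}"
  shows "(\<exists>n. visits n x \<ge> m) \<longleftrightarrow> m \<le> total_visits x"
proof
  assume "m \<le> total_visits x"
  moreover obtain N where "\<And>j. partial_sum j x = 0 \<Longrightarrow> j \<le> N"
    using assms by (auto simp: finite_nat_set_iff_bounded_le)
  then have "visits N x = total_visits x"
    by (intro visits_eq_total) (auto simp: not_less[symmetric])
  ultimately show "\<exists>n. visits n x \<ge> m" by metis
qed (use visits_le_total[OF assms] in \<open>blast intro: order_trans\<close>)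

text \<open>Infinitely many visits imply at least \<open>Suc m\<close> visits for every
  \<open>m\<close>, an event of probability \<open>return_prob ^ m\<close>, which tends to
  0.\<close>

lemma AE_finite_visits:
  assumes "return_prob < 1"
  shows "AE x in S. finite {j. partial_sum j x = 0}"
proof -
  let ?Z = "{x. infinite {j. partial_sum j x = 0}}"
  have Z: "?Z \<in> sets S"
    unfolding infinite_nat_iff_unbounded_le mem_Collect_eq by (rule pred_eq_sets) measurable
  have "P.prob ?Z \<le> return_prob ^ m" for m
    unfolding prob_visits_Suc[symmetric]
  proof (rule P.finite_measure_mono)
    show "{x. \<exists>n. visits n x \<ge> Suc m} \<in> sets S" by (rule pred_eq_sets) measurable
    show "?Z \<subseteq> {x. \<exists>n. visits n x \<ge> Suc m}"
    proof
      fix x assume "x \<in> ?Z"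
      then have "infinite {j. partial_sum j x = 0}" by simp
      from infinite_arbitrarily_large[OF this, of "Suc m"]
      obtain B where B: "finite B" "card B = Suc m" "B \<subseteq> {j. partial_sum j x = 0}" by blast
      \<comment> \<open>The horizon \<open>Max B\<close> is late enough to see all the chosen
        visits.\<close>
      then have "B \<subseteq> {j. j \<le> Max B \<and> partial_sum j x = 0}" by auto
      from card_mono[OF _ this] B show "x \<in> {x. \<exists>n. visits n x \<ge> Suc m}"
        by (auto simp: visits_def)
    qed
  qed
  moreover have "(\<lambda>m. return_prob ^ m) \<longlonglongrightarrow> 0"
    using assms return_prob_nonneg by (intro LIMSEQ_power_zero) auto
  ultimately have "P.prob ?Z \<le> 0"
    by (intro LIMSEQ_le_const) auto
  then have "P.prob ?Z = 0" by (simp add: measure_le_0_iff)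
  then show ?thesis
    using P.prob_eq_0[OF Z] by simp
qed

lemma prob_total_visits_ge:
  assumes "return_prob < 1"
  shows "P.prob {x. Suc m \<le> total_visits x} = return_prob ^ m"
  unfolding prob_visits_Suc[symmetric]
proof (rule P.finite_measure_eq_AE)
  show "AE x in S. x \<in> {x. Suc m \<le> total_visits x} \<longleftrightarrow> x \<in> {x. \<exists>n. visits n x \<ge> Suc m}"
    using AE_finite_visits[OF assms] by eventually_elim (simp add: visits_ge_iff_total_visits_ge)
  show "{x. Suc m \<le> total_visits x} \<in> sets S" by (rule sets_total_visits)
  show "{x. \<exists>n. visits n x \<ge> Suc m} \<in> sets S" by (rule pred_eq_sets) measurable
qed

text \<open>Successive tail probabilities are subtracted. Since time 0 is always a visit, the value
  0 can only be the default for infinitely many visits, and it has probability 0.\<close>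

lemma prob_total_visits_eq:
  assumes "return_prob < 1"
  shows "P.prob {x. total_visits x = m} = (if m = 0 then 0 else (1 - return_prob) * return_prob ^ (m - 1))"
proof -
  have m: "{x. k \<le> total_visits x} \<in> sets S" for k
    by (rule sets_total_visits)
  have "P.prob {x. total_visits x = m} = P.prob ({x. m \<le> total_visits x} - {x. Suc m \<le> total_visits x})"
    by (intro arg_cong[where f=P.prob]) auto
  also have "\<dots> = P.prob {x. m \<le> total_visits x} - P.prob {x. Suc m \<le> total_visits x}"
    using m by (intro P.finite_measure_Diff) auto
  also have "P.prob {x. Suc m \<le> total_visits x} = return_prob ^ m"
    by (rule prob_total_visits_ge[OF assms])
  finally show ?thesis
    using prob_total_visits_ge[OF assms, of "m - 1"] P.prob_space
    by (cases m) (auto simp: space_S algebra_simps)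
qed

text \<open>The law of \<open>total_visits\<close> has the point probabilities as density with
  respect to counting measure, so integrals become series; these start at 1 because the value 0
  carries no mass.\<close>

lemma total_visits_expectation:
  fixes h :: "nat \<Rightarrow> real"
  assumes p: "return_prob < 1" and h: "summable (\<lambda>m. \<bar>h (Suc m)\<bar> * return_prob ^ m)"
  shows "integrable S (\<lambda>x. h (total_visits x))"
    and "(\<integral>x. h (total_visits x) \<partial>S) = (1 - return_prob) * (\<Sum>m. h (Suc m) * return_prob ^ m)"
proof -
  let ?q = "\<lambda>m. P.prob {x. total_visits x = m}"
  let ?D = "distr S (count_space UNIV) total_visits"
  have D: "?D = density (count_space UNIV) (\<lambda>m. ennreal (?q m))"
  proof (rule measure_eqI_countable[of _ UNIV])
    fix m :: nat
    have "emeasure ?D {m} = emeasure S {x. total_visits x = m}"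
      by (subst emeasure_distr) (auto simp: space_S vimage_def)
    also have "\<dots> = emeasure (density (count_space UNIV) (\<lambda>m. ennreal (?q m))) {m}"
      by (subst emeasure_density) (simp_all add: P.emeasure_eq_measure nn_integral_count_space_indicator[symmetric] nn_integral_count_space_finite)
    finally show "emeasure ?D {m} = emeasure (density (count_space UNIV) (\<lambda>m. ennreal (?q m))) {m}" .
  qed auto
  have q: "?q (Suc m) = (1 - return_prob) * return_prob ^ m" "?q 0 = 0" for m
    using prob_total_visits_eq[OF p] by simp_all
  have "summable (\<lambda>m. (1 - return_prob) * (\<bar>h (Suc m)\<bar> * return_prob ^ m))"
    by (intro summable_mult h)
  also have "(\<lambda>m. (1 - return_prob) * (\<bar>h (Suc m)\<bar> * return_prob ^ m))
      = (\<lambda>m. norm (?q (Suc m) * h (Suc m)))"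
    using p return_prob_nonneg by (simp add: q abs_mult mult_ac)
  finally have "summable (\<lambda>m. norm (?q m * h m))"
    by (subst summable_Suc_iff[symmetric])
  then have i: "integrable (count_space UNIV) (\<lambda>m. ?q m * h m)"
    by (simp add: integrable_count_space_nat_iff)
  then have iD: "integrable ?D h"
    unfolding D by (subst integrable_density) auto
  then show "integrable S (\<lambda>x. h (total_visits x))"
    by (subst (asm) integrable_distr_eq) auto
  have "(\<integral>x. h (total_visits x) \<partial>S) = (\<integral>m. h m \<partial>?D)"
    by (rule integral_distr[symmetric]) auto
  also have "\<dots> = (\<integral>m. ?q m * h m \<partial>count_space UNIV)"
    unfolding D by (subst integral_density) auto
  also have "\<dots> = (\<Sum>m. ?q m * h m)"
    by (rule integral_count_space_nat[OF i])
  also have "\<dots> = (\<Sum>m. ?q (Suc m) * h (Suc m))"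
    using suminf_split_head[of "\<lambda>m. ?q m * h m"] i q(2)
    by (simp add: integrable_count_space_nat_iff summable_norm_cancel)
  also have "\<dots> = (\<Sum>m. (1 - return_prob) * (h (Suc m) * return_prob ^ m))"
    by (simp add: q mult_ac)
  also have "\<dots> = (1 - return_prob) * (\<Sum>m. h (Suc m) * return_prob ^ m)"
  proof (rule suminf_mult)
    show "summable (\<lambda>m. h (Suc m) * return_prob ^ m)"
      by (rule summable_norm_cancel) (use h return_prob_nonneg in \<open>simp add: abs_mult\<close>)
  qed
  finally show "(\<integral>x. h (total_visits x) \<partial>S) = (1 - return_prob) * (\<Sum>m. h (Suc m) * return_prob ^ m)" .
qed

end

section \<open>Occupation averages\<close>

text \<open>Factor \<open>a (k n) / n\<close> as \<open>a (k n) / k n\<close> times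
  \<open>k n / n\<close>. This lets Birkhoff averages be used with endpoints \<open>Suc n\<close>
  and \<open>n - K\<close>.\<close>

lemma tendsto_average_subseq:
  fixes a :: "nat \<Rightarrow> real" and k :: "nat \<Rightarrow> nat"
  assumes a: "(\<lambda>n. a n / real n) \<longlonglongrightarrow> L"
    and k: "filterlim k at_top sequentially" "(\<lambda>n. real (k n) / real n) \<longlonglongrightarrow> 1"
  shows "(\<lambda>n. a (k n) / real n) \<longlonglongrightarrow> L"
proof -
  have "(\<lambda>n. a (k n) / real (k n) * (real (k n) / real n)) \<longlonglongrightarrow> L * 1"
    by (intro tendsto_mult k(2) filterlim_compose[OF a k(1)])
  moreover have "\<forall>\<^sub>F n in sequentially. a (k n) / real (k n) * (real (k n) / real n) = a (k n) / real n"
    using k(1)[unfolded filterlim_at_top, rule_format, of 1] by eventually_elim simp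
  ultimately have "(\<lambda>n. a (k n) / real n) \<longlonglongrightarrow> L * 1"
    by (rule Lim_transform_eventually)
  then show ?thesis by simp
qed

lemma tendsto_average_Suc:
  fixes a :: "nat \<Rightarrow> real"
  assumes "(\<lambda>n. a n / real n) \<longlonglongrightarrow> L"
  shows "(\<lambda>n. a (Suc n) / real n) \<longlonglongrightarrow> L"
  by (rule tendsto_average_subseq[OF assms filterlim_Suc]) real_asymp

lemma tendsto_average_diff:
  fixes a :: "nat \<Rightarrow> real"
  assumes "(\<lambda>n. a n / real n) \<longlonglongrightarrow> L"
  shows "(\<lambda>n. a (n - K) / real n) \<longlonglongrightarrow> L"
proof (rule tendsto_average_subseq[OF assms])
  show "filterlim (\<lambda>n. n - K) at_top sequentially"
    by (rule filterlim_minus_const_nat_at_top)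
  have "(\<lambda>n. (real n - real K) / real n) \<longlonglongrightarrow> 1" by real_asymp
  moreover have "\<forall>\<^sub>F n in sequentially. (real n - real K) / real n = real (n - K) / real n"
    using eventually_ge_at_top[of K] by eventually_elim (simp add: of_nat_diff)
  ultimately show "(\<lambda>n. real (n - K) / real n) \<longlonglongrightarrow> 1"
    by (simp add: tendsto_cong)
qed

text \<open>The series is the Cauchy product of the given one with the geometric series. For
  \<open>p = return_prob\<close> it yields integrability of \<open>H\<close> at the total number of
  visits.\<close>

lemma summable_weighted_partial_sums:
  fixes f :: "nat \<Rightarrow> real" and p :: real
  assumes p: "0 \<le> p" "p < 1" and f: "summable (\<lambda>m. \<bar>f (Suc m)\<bar> * p ^ m)" "f 0 = 0"
  shows "summable (\<lambda>m. (\<Sum>k\<le>Suc m. \<bar>f k\<bar>) * p ^ m)"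
proof -
  have "summable (\<lambda>m. \<Sum>k\<le>m. \<bar>f (Suc k)\<bar> * p ^ k * p ^ (m - k))"
    using p f by (intro summable_Cauchy_product) (auto simp: abs_mult)
  also have "(\<lambda>m. \<Sum>k\<le>m. \<bar>f (Suc k)\<bar> * p ^ k * p ^ (m - k)) = (\<lambda>m. (\<Sum>k\<le>Suc m. \<bar>f k\<bar>) * p ^ m)"
  proof
    fix m
    have "(\<Sum>k\<le>m. \<bar>f (Suc k)\<bar> * p ^ k * p ^ (m - k)) = (\<Sum>k\<le>m. \<bar>f (Suc k)\<bar> * p ^ m)"
      by (intro sum.cong) (auto simp: mult.assoc simp flip: power_add)
    also have "\<dots> = (\<Sum>k\<le>Suc m. \<bar>f k\<bar>) * p ^ m"
      by (simp only: sum.atMost_Suc_shift f(2) sum_distrib_right[symmetric]) simp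
    finally show "(\<Sum>k\<le>m. \<bar>f (Suc k)\<bar> * p ^ k * p ^ (m - k)) = (\<Sum>k\<le>Suc m. \<bar>f k\<bar>) * p ^ m" .
  qed
  finally show ?thesis .
qed

context iid_steps
begin

text \<open>In the limit, one factor \<open>1 - return_prob\<close> comes from the geometric law and
  the other from summation by parts for the differences \<open>g\<close>.\<close>

theorem AE_occupation_average:
  fixes f :: "nat \<Rightarrow> real"
  defines "g \<equiv> \<lambda>m. f m - f (m - 1)"
  assumes p: "return_prob < 1"
    and f: "summable (\<lambda>m. \<bar>f (Suc m)\<bar> * return_prob ^ m)" "f 0 = 0"
  shows "AE x in S. (\<lambda>n. (\<Sum>i\<le>n. g (visits (n - i) (shift_seq i x))) / real n)
    \<longlonglongrightarrow> (1 - return_prob)\<^sup>2 * (\<Sum>m. f (Suc m) * return_prob ^ m)"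
proof -
  define p where "p = return_prob"
  have p01: "0 \<le> p" "p < 1" using p return_prob_nonneg by (auto simp: p_def)
  define H where "H m = (\<Sum>k\<le>m. \<bar>f k\<bar>)" for m
  define gR where "gR x = g (total_visits x)" for x :: "nat \<Rightarrow> int ^ 'd"
  define HR where "HR x = H (total_visits x)" for x :: "nat \<Rightarrow> int ^ 'd"
  \<comment> \<open>The dominating error, restricted to the event of a return after more than
    \<open>K\<close> steps.\<close>
  define \<psi> where "\<psi> K x = HR x * of_bool (\<exists>j>K. partial_sum j x = 0)" for K and x :: "nat \<Rightarrow> int ^ 'd"
  have H0: "H m \<ge> 0" for m by (simp add: H_def sum_nonneg)
  have Hs: "summable (\<lambda>m. \<bar>H (Suc m)\<bar> * p ^ m)"
    using summable_weighted_partial_sums[OF p01] f by (simp add: H_def p_def sum_nonneg)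
  have gH: "\<bar>g (Suc m)\<bar> \<le> \<bar>H (Suc m)\<bar>" for m
  proof -
    have "\<bar>f (Suc m) - f m\<bar> \<le> \<bar>f (Suc m)\<bar> + \<bar>f m\<bar>" by linarith
    also have "\<dots> \<le> H (Suc m)" by (cases m) (auto simp: H_def sum_nonneg)
    finally show ?thesis by (simp add: g_def)
  qed
  have gs: "summable (\<lambda>m. \<bar>g (Suc m)\<bar> * p ^ m)"
    using p01 gH by (intro summable_comparison_test'[OF Hs, of 0]) (auto simp: abs_mult intro!: mult_right_mono)
  note intg = total_visits_expectation[OF p gs[unfolded p_def], folded gR_def p_def]
  note intH = total_visits_expectation(1)[OF p Hs[unfolded p_def], folded HR_def]
  have fs: "summable (\<lambda>m. f (Suc m) * p ^ m)"
    by (rule summable_norm_cancel) (use f p01 in \<open>simp add: abs_mult p_def\<close>)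
  \<comment> \<open>Summation by parts: since \<open>f 0 = 0\<close>, the series of
    \<open>f m * p ^ m\<close> is \<open>p\<close> times that of \<open>f (Suc m) * p ^ m\<close>,
    and subtracting it leaves the factor \<open>1 - p\<close>.\<close>
  have "(\<lambda>m. p * (f (Suc m) * p ^ m)) sums (p * (\<Sum>m. f (Suc m) * p ^ m))"
    by (intro sums_mult summable_sums fs)
  then have "(\<lambda>m. f (Suc m) * p ^ Suc m) sums (p * (\<Sum>m. f (Suc m) * p ^ m))"
    by (simp add: mult_ac)
  then have "(\<lambda>m. f m * p ^ m) sums (p * (\<Sum>m. f (Suc m) * p ^ m))"
    by (subst (asm) sums_Suc_iff) (simp add: f(2))
  from sums_diff[OF summable_sums[OF fs] this]
  have "(\<lambda>m. g (Suc m) * p ^ m) sums ((1 - p) * (\<Sum>m. f (Suc m) * p ^ m))"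
    by (simp add: g_def algebra_simps)
  with intg(2) have Eg: "(\<integral>x. gR x \<partial>S) = (1 - p)\<^sup>2 * (\<Sum>m. f (Suc m) * p ^ m)"
    by (simp add: sums_iff power2_eq_square)
  have \<psi>m [measurable]: "\<psi> K \<in> borel_measurable S" for K
  proof -
    have [measurable]: "HR \<in> borel_measurable S" using intH by blast
    show ?thesis unfolding \<psi>_def[abs_def] by measurable
  qed
  have \<psi>b: "0 \<le> \<psi> K x" "\<psi> K x \<le> HR x" for K x
    using H0 by (auto simp: \<psi>_def HR_def)
  have int\<psi>: "integrable S (\<psi> K)" for K
  proof (rule Bochner_Integration.integrable_bound[OF intH])
    show "AE x in S. norm (\<psi> K x) \<le> norm (HR x)"
    proof (rule AE_I2)
      show "norm (\<psi> K x) \<le> norm (HR x)" for x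
        using \<psi>b(1)[of K x] \<psi>b(2)[of K x] by simp
    qed
  qed measurable
  have \<psi>0: "(\<lambda>K. \<integral>x. \<psi> K x \<partial>S) \<longlonglongrightarrow> (\<integral>x. 0 \<partial>S)"
  proof (rule integral_dominated_convergence[OF _ _ intH])
    show "AE x in S. (\<lambda>K. \<psi> K x) \<longlonglongrightarrow> 0"
      using AE_finite_visits[OF p]
    proof eventually_elim
      case (elim x)
      then obtain N where N: "\<And>j. partial_sum j x = 0 \<Longrightarrow> j \<le> N"
        by (auto simp: finite_nat_set_iff_bounded_le)
      have "\<forall>\<^sub>F K in sequentially. \<psi> K x = 0"
        using eventually_ge_at_top[of N]
        by eventually_elim (use N in \<open>fastforce simp: \<psi>_def\<close>)
      then show ?case by (rule tendsto_eventually)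
    qed
  qed (use \<psi>b in auto)
  have "AE x in S. \<forall>i. finite {j. partial_sum j (shift_seq i x) = 0}"
    unfolding AE_all_countable by (intro allI AE_shift AE_finite_visits p)
  moreover have "AE x in S. \<forall>K. (\<lambda>n. birkhoff_sum (\<psi> K) n x / real n) \<longlonglongrightarrow> (\<integral>x. \<psi> K x \<partial>S)"
    unfolding AE_all_countable by (intro allI birkhoff int\<psi>)
  moreover note birkhoff[OF intg(1)] birkhoff[OF intH]
  ultimately have "AE x in S. (\<lambda>n. (\<Sum>i\<le>n. g (visits (n - i) (shift_seq i x))) / real n) \<longlonglongrightarrow> (\<integral>x. gR x \<partial>S)"
  proof eventually_elim
    case (elim x)
    let ?a = "\<lambda>n. \<Sum>i\<le>n. g (visits (n - i) (shift_seq i x))"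
    let ?b = "\<lambda>n. birkhoff_sum gR (Suc n) x"
    \<comment> \<open>Indices below \<open>n - K\<close> are charged to \<open>\<psi> K\<close>, the
      remaining ones up to \<open>n\<close> to \<open>HR\<close>. Writing the latter part as a
      difference of Birkhoff sums makes its average vanish in the limit.\<close>
    let ?c = "\<lambda>K n. birkhoff_sum (\<psi> K) n x + birkhoff_sum HR (Suc n) x - birkhoff_sum HR (n - K) x"
    have bound: "\<bar>?a n - ?b n\<bar> \<le> 2 * ?c K n" for K n
    proof -
      have "\<bar>?a n - ?b n\<bar> = \<bar>\<Sum>i<Suc n. g (visits (n - i) (shift_seq i x)) - gR (shift_seq i x)\<bar>"
        by (simp only: birkhoff_sum_def sum_subtractf lessThan_Suc_atMost)
      also have "\<dots> \<le> (\<Sum>i<Suc n. 2 * (if i < n - K then \<psi> K (shift_seq i x) else HR (shift_seq i x)))"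
      proof (rule order_trans[OF sum_abs sum_mono])
        fix i assume "i \<in> {..<Suc n}"
        have "\<bar>g (visits (n - i) (shift_seq i x)) - gR (shift_seq i x)\<bar> \<le> 2 * \<psi> (n - i) (shift_seq i x)"
          using abs_diff_visits_le[of "shift_seq i x" f "n - i"] elim(1)
          by (simp add: g_def gR_def \<psi>_def HR_def H_def)
        \<comment> \<open>Here \<open>n - i > K\<close>, so a return later than \<open>n - i\<close>
          is also later than \<open>K\<close>.\<close>
        moreover have "\<psi> (n - i) (shift_seq i x) \<le> \<psi> K (shift_seq i x)" if "i < n - K"
        proof -
          have "\<exists>j>K. partial_sum j (shift_seq i x) = 0"
            if "j > n - i" "partial_sum j (shift_seq i x) = 0" for j
            using that \<open>i < n - K\<close> by (intro exI[of _ j]) auto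
          then show ?thesis using H0 by (auto simp: \<psi>_def HR_def)
        qed
        moreover have "\<psi> (n - i) (shift_seq i x) \<le> HR (shift_seq i x)"
          by (rule \<psi>b)
        ultimately show "\<bar>g (visits (n - i) (shift_seq i x)) - gR (shift_seq i x)\<bar>
            \<le> 2 * (if i < n - K then \<psi> K (shift_seq i x) else HR (shift_seq i x))"
          by (smt (verit))
      qed
      also have "\<dots> = 2 * ((\<Sum>i<n - K. \<psi> K (shift_seq i x)) + (\<Sum>i=n - K..<Suc n. HR (shift_seq i x)))"
      proof -
        let ?h = "\<lambda>i. if i < n - K then \<psi> K (shift_seq i x) else HR (shift_seq i x)"
        have "{..<Suc n} = {..<n - K} \<union> {n - K..<Suc n}" by auto
        then have "(\<Sum>i<Suc n. ?h i) = (\<Sum>i\<in>{..<n - K} \<union> {n - K..<Suc n}. ?h i)"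
          by (rule arg_cong)
        also have "\<dots> = (\<Sum>i<n - K. ?h i) + (\<Sum>i=n - K..<Suc n. ?h i)"
          by (rule sum.union_disjoint) auto
        also have "\<dots> = (\<Sum>i<n - K. \<psi> K (shift_seq i x)) + (\<Sum>i=n - K..<Suc n. HR (shift_seq i x))"
          by (intro arg_cong2[where f="(+)"] sum.cong) auto
        finally show ?thesis unfolding sum_distrib_left[symmetric] by simp
      qed
      finally have "\<bar>?a n - ?b n\<bar>
          \<le> 2 * ((\<Sum>i<n - K. \<psi> K (shift_seq i x)) + (\<Sum>i=n - K..<Suc n. HR (shift_seq i x)))" .
      moreover have "(\<Sum>i<n - K. \<psi> K (shift_seq i x)) \<le> birkhoff_sum (\<psi> K) n x"
        unfolding birkhoff_sum_def using \<psi>b(1) by (intro sum_mono2) auto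
      moreover have "birkhoff_sum HR (Suc n) x
          = birkhoff_sum HR (n - K) x + (\<Sum>i=n - K..<Suc n. HR (shift_seq i x))"
        unfolding birkhoff_sum_def lessThan_atLeast0
        by (rule sum.atLeastLessThan_concat[symmetric]) auto
      ultimately show ?thesis by argo
    qed
    have b: "(\<lambda>n. ?b n / real n) \<longlonglongrightarrow> (\<integral>x. gR x \<partial>S)"
      by (rule tendsto_average_Suc) (use elim in blast)
    have c: "(\<lambda>n. 2 * (?c K n / real n)) \<longlonglongrightarrow> 2 * ((\<integral>x. \<psi> K x \<partial>S) + (\<integral>x. HR x \<partial>S) - (\<integral>x. HR x \<partial>S))" for K
      unfolding diff_divide_distrib add_divide_distrib
      by (intro tendsto_intros tendsto_average_Suc tendsto_average_diff) (use elim in blast)+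
    \<comment> \<open>First \<open>K\<close> is chosen to make the integral of
      \<open>\<psi> K\<close> small; then \<open>n\<close> tends to infinity with \<open>K\<close>
      fixed.\<close>
    have "(\<lambda>n. ?a n / real n - ?b n / real n) \<longlonglongrightarrow> 0"
    proof (rule tendstoI)
      fix r :: real assume "r > 0"
      then have "\<forall>\<^sub>F K in sequentially. (\<integral>x. \<psi> K x \<partial>S) < r / 2"
        using \<psi>0 by (intro order_tendstoD) auto
      then obtain K where "(\<integral>x. \<psi> K x \<partial>S) < r / 2"
        by (auto dest: eventually_happens)
      then have "\<forall>\<^sub>F n in sequentially. 2 * (?c K n / real n) < r"
        by (intro order_tendstoD(2)[OF c]) simp
      then show "\<forall>\<^sub>F n in sequentially. dist (?a n / real n - ?b n / real n) 0 < r"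
      proof eventually_elim
        case (elim n)
        have "\<bar>?a n / real n - ?b n / real n\<bar> = \<bar>?a n - ?b n\<bar> / real n"
          by (simp add: diff_divide_distrib[symmetric])
        also have "\<dots> \<le> 2 * ?c K n / real n"
          by (intro divide_right_mono bound) auto
        finally show ?case using elim by simp
      qed
    qed
    from tendsto_add[OF this b] show ?case by simp
  qed
  then show ?thesis by (simp add: Eg p_def)
qed

end

section \<open>Transfer to the given random walk\<close>

text \<open>Cauchy condensation: \<open>ln (2 ^ n)\<close> is \<open>n * ln 2\<close>, so the
  condensed terms are at most a constant times \<open>n powr - s\<close>.\<close>

lemma summable_one_over_ln_powr:
  assumes "s > 1"
  shows "summable (\<lambda>n. 1 / (real (n + 2) * ln (real (n + 2)) powr s))"
proof (subst condensation_test)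
  show "1 / (real (Suc m + 2) * ln (real (Suc m + 2)) powr s) \<le> 1 / (real (m + 2) * ln (real (m + 2)) powr s)" for m
    using assms by (intro divide_left_mono mult_mono powr_mono2) auto
  have "summable (\<lambda>n. (1 / ln 2 powr s) * real n powr - s)"
    using assms by (intro summable_mult) (subst summable_real_powr_iff, simp)
  then show "summable (\<lambda>n. 2 ^ n * (1 / (real (2 ^ n + 2) * ln (real (2 ^ n + 2)) powr s)))"
  \<comment> \<open>At \<open>n = 0\<close> the comparison term is 0, because
    \<open>0 powr - s = 0\<close>, while the condensed term is positive.\<close>
  proof (rule summable_comparison_test'[where N=1])
    fix n :: nat assume n: "n \<ge> 1"
    have "real n * ln 2 = ln (2 ^ n)" by (simp add: ln_realpow)
    also have "\<dots> \<le> ln (real (2 ^ n + 2))" by (intro ln_mono) (auto intro: add_pos_pos)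
    finally have *: "(real n * ln 2) powr s \<le> ln (real (2 ^ n + 2)) powr s"
      using n assms by (intro powr_mono2) auto
    have pos: "0 < (real n * ln 2) powr s" using n by simp
    have "2 ^ n * (1 / (real (2 ^ n + 2) * ln (real (2 ^ n + 2)) powr s))
        \<le> 2 ^ n * (1 / (2 ^ n * (real n * ln 2) powr s))"
      using * pos less_le_trans[OF pos *]
      by (intro mult_left_mono divide_left_mono mult_mono mult_pos_pos) (auto intro: add_pos_pos)
    also have "\<dots> = (1 / ln 2 powr s) * real n powr - s"
      by (simp add: powr_mult powr_minus field_simps)
    finally show "norm (2 ^ n * (1 / (real (2 ^ n + 2) * ln (real (2 ^ n + 2)) powr s)))
        \<le> (1 / ln 2 powr s) * real n powr - s"
      by simp
  qed
qed auto

text \<open>The exponential is \<open>(1 / p) ^ i\<close>; with \<open>i = Suc m\<close> it cancels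
  \<open>p ^ m\<close> up to one factor \<open>1 / p\<close>. For \<open>p = 1 - \<gamma>\<close>
  the exponent is \<open>i\<close> times \<open>lambda_star\<close>.\<close>

lemma summable_geometric_envelope:
  fixes f b :: "nat \<Rightarrow> real" and C p :: real
  assumes p: "0 < p" and b: "summable b"
    and bound: "\<And>i. i \<ge> i0 \<Longrightarrow> \<bar>f i\<bar> \<le> C * exp (real i * ln (1 / p)) * b i"
  shows "summable (\<lambda>m. \<bar>f (Suc m)\<bar> * p ^ m)"
proof (rule summable_comparison_test')
  show "summable (\<lambda>m. (C / p) * b (Suc m))"
    using b by (intro summable_mult) (simp add: summable_Suc_iff)
  fix m assume "m \<ge> i0"
  then have "\<bar>f (Suc m)\<bar> * p ^ m \<le> C * exp (real (Suc m) * ln (1 / p)) * b (Suc m) * p ^ m"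
    using p by (intro mult_right_mono bound) auto
  also have "exp (real (Suc m) * ln (1 / p)) = (1 / p) ^ Suc m"
    using p by (subst exp_of_nat_mult) simp
  also have "C * (1 / p) ^ Suc m * b (Suc m) * p ^ m = (C / p) * b (Suc m)"
    using p by (simp add: field_simps)
  finally show "norm (\<bar>f (Suc m)\<bar> * p ^ m) \<le> (C / p) * b (Suc m)"
    using p by simp
qed

section \<open>From the given probability space to the product space and back\<close>

definition steps_seq :: "(nat \<Rightarrow> 'a \<Rightarrow> int ^ 'd) \<Rightarrow> 'a \<Rightarrow> nat \<Rightarrow> int ^ 'd" where
  "steps_seq X \<omega> = (\<lambda>i. X (Suc i) \<omega>)"

lemma walk_eq_partial_sum: "walk X n \<omega> = partial_sum n (steps_seq X \<omega>)"
  unfolding walk_def partial_sum_def steps_seq_def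
  by (rule sum.reindex_bij_witness[of _ Suc "\<lambda>i. i - 1"]) auto

lemma G_eq_sum_visits:
  assumes "f 0 = 0"
  shows "G X f n \<omega> = (\<Sum>i\<le>n. f (visits (n - i) (shift_seq i (steps_seq X \<omega>)))
    - f (visits (n - i) (shift_seq i (steps_seq X \<omega>)) - 1))"
proof -
  let ?x = "steps_seq X \<omega>"
  have lt: "local_time X n y \<omega> = card {i. i \<le> n \<and> partial_sum i ?x = y}" for y
    by (simp add: local_time_def walk_eq_partial_sum atMost_atLeast0[symmetric] Int_def)
  have "{y. local_time X n y \<omega> \<ge> 1} = (\<lambda>i. partial_sum i ?x) ` {..n}"
    by (auto simp: lt Suc_le_eq card_gt_0_iff)
  then show ?thesis
    unfolding G_def by (simp add: lt sum_local_times_eq[where f=f, OF assms])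
qed

text \<open>Independence makes the joint law on \<open>{1..}\<close> a product, equal marginals make
  all its factors \<open>N\<close>, and reindexing along \<open>Suc\<close> moves the index set to
  all of \<open>nat\<close>.\<close>

lemma (in prob_space) distr_steps_seq:
  assumes ind: "indep_vars (\<lambda>_. count_space UNIV) X {1..}"
    and id: "\<And>i. i \<ge> 1 \<Longrightarrow> distr M (count_space UNIV) (X i) = distr M (count_space UNIV) (X 1)"
  defines "N \<equiv> distr M (count_space UNIV) (X 1)"
  shows "steps_seq X \<in> measurable M (Pi\<^sub>M UNIV (\<lambda>_. N))"
    and "distr M (Pi\<^sub>M UNIV (\<lambda>_. N)) (steps_seq X) = Pi\<^sub>M UNIV (\<lambda>_. N)"
proof -
  have rv: "X i \<in> measurable M (count_space UNIV)" if "i \<ge> 1" for i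
    using ind that by (auto simp: indep_vars_def)
  then have rvN: "X i \<in> measurable M N" if "i \<ge> 1" for i
    using that by (simp add: N_def)
  have "prob_space N"
    unfolding N_def by (intro prob_space_distr rv) simp
  have meas: "(\<lambda>\<omega>. \<lambda>i\<in>{1..}. X i \<omega>) \<in> measurable M (Pi\<^sub>M {1..} (\<lambda>_. N))"
    by (rule measurable_restrict) (auto intro: rvN)
  have "distr M (Pi\<^sub>M {1..} (\<lambda>_. count_space UNIV)) (\<lambda>\<omega>. \<lambda>i\<in>{1..}. X i \<omega>)
      = Pi\<^sub>M {1..} (\<lambda>i. distr M (count_space UNIV) (X i))"
    using ind rv by (subst (asm) indep_vars_iff_distr_eq_PiM') auto
  also have "\<dots> = Pi\<^sub>M {1..} (\<lambda>_. N)"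
    unfolding N_def by (intro PiM_cong refl id) auto
  also have "distr M (Pi\<^sub>M {1..} (\<lambda>_. count_space UNIV)) (\<lambda>\<omega>. \<lambda>i\<in>{1..}. X i \<omega>)
      = distr M (Pi\<^sub>M {1..} (\<lambda>_. N)) (\<lambda>\<omega>. \<lambda>i\<in>{1..}. X i \<omega>)"
    by (intro distr_cong refl sets_PiM_cong) (simp add: N_def)
  finally have D: "distr M (Pi\<^sub>M {1..} (\<lambda>_. N)) (\<lambda>\<omega>. \<lambda>i\<in>{1..}. X i \<omega>) = Pi\<^sub>M {1..} (\<lambda>_. N)" .
  show S: "steps_seq X \<in> measurable M (Pi\<^sub>M UNIV (\<lambda>_. N))"
    unfolding steps_seq_def
    by (rule measurable_PiM_single'[where f="\<lambda>i. X (Suc i)"]) (simp_all add: rvN space_PiM PiE_iff, simp add: N_def)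
  have r: "(\<lambda>x. \<lambda>i\<in>UNIV. x (Suc i)) \<in> measurable (Pi\<^sub>M {1..} (\<lambda>_. N)) (Pi\<^sub>M UNIV (\<lambda>_. N))"
    by (rule measurable_restrict) (auto intro: measurable_component_singleton)
  have "Pi\<^sub>M UNIV (\<lambda>_. N) = distr (Pi\<^sub>M {1..} (\<lambda>_. N)) (Pi\<^sub>M UNIV (\<lambda>_. N)) (\<lambda>x. \<lambda>i\<in>UNIV. x (Suc i))"
    using distr_PiM_reindex[of "{1::nat..}" "\<lambda>_. N" Suc UNIV] \<open>prob_space N\<close> by simp
  also have "\<dots> = distr M (Pi\<^sub>M UNIV (\<lambda>_. N)) (\<lambda>\<omega>. \<lambda>i\<in>UNIV. X (Suc i) \<omega>)"
    by (subst D[symmetric], subst distr_distr[OF r meas]) (simp add: comp_def)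
  finally have "distr M (Pi\<^sub>M UNIV (\<lambda>_. N)) (\<lambda>\<omega>. \<lambda>i\<in>UNIV. X (Suc i) \<omega>) = Pi\<^sub>M UNIV (\<lambda>_. N)"
    by (rule sym)
  then show "distr M (Pi\<^sub>M UNIV (\<lambda>_. N)) (steps_seq X) = Pi\<^sub>M UNIV (\<lambda>_. N)"
    by (simp only: steps_seq_def[abs_def] restrict_UNIV)
qed

theorem theorem4:
  fixes M :: "'a measure"
    and X :: "nat \<Rightarrow> 'a \<Rightarrow> int ^ 'd"
    and f :: "nat \<Rightarrow> real"
    and C \<epsilon> :: real
  assumes "prob_space M"
    and "prob_space.indep_vars M (\<lambda>_. count_space UNIV) X {1..}"
    and "\<And>i. i \<ge> 1 \<Longrightarrow>
           distr M (count_space UNIV) (X i) = distr M (count_space UNIV) (X 1)"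
    and "transient M X"
    and "escape_prob M X < 1"
    and "\<epsilon> > 0"
    and "((\<exists>\<eta>::real. 0 < \<eta> \<and> \<eta> < 1 \<and>
             (\<forall>n\<ge>1. (\<Sum>k = 1..n. real k * \<P>(\<omega> in M. walk X k \<omega> = 0))
                     \<le> C * real n powr (1 - \<eta>))) \<and>
          (\<forall>i\<ge>1. \<bar>f i\<bar> \<le> C * exp (real i * lambda_star M X) / real i powr (2 + \<epsilon>)))
       \<or> ((\<forall>n\<ge>2. (\<Sum>k = 1..n. real k * \<P>(\<omega> in M. walk X k \<omega> = 0)) \<le> C * ln (real n)) \<and>
          (\<forall>i\<ge>2. \<bar>f i\<bar> \<le> C * exp (real i * lambda_star M X)
                           / (real i * ln (real i) powr (2 + \<epsilon>))))"
  shows "summable (\<lambda>j. f (Suc j) * (1 - escape_prob M X) ^ j) \<and>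
    (AE \<omega> in M. (\<lambda>n. G X f n \<omega> / real n)
       \<longlonglongrightarrow> (escape_prob M X)\<^sup>2 * (\<Sum>j. f (Suc j) * (1 - escape_prob M X) ^ j))"
proof -
  interpret prob_space M by fact
  define N where "N = distr M (count_space UNIV) (X 1)"
  have steps: "steps_seq X \<in> measurable M (Pi\<^sub>M UNIV (\<lambda>_. N))"
    "distr M (Pi\<^sub>M UNIV (\<lambda>_. N)) (steps_seq X) = Pi\<^sub>M UNIV (\<lambda>_. N)"
    unfolding N_def
    by (rule distr_steps_seq[OF assms(2)], rule assms(3), assumption)+
  have "X 1 \<in> measurable M (count_space UNIV)"
    using assms(2) by (auto simp: indep_vars_def)
  then have "prob_space N"
    unfolding N_def by (rule prob_space_distr)
  then interpret N: prob_space N .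
  interpret iid_steps N
    by unfold_locales (simp add: N_def)
  \<comment> \<open>The escape event depends on the steps only, so its probability can be computed
    under their law \<open>S\<close>.\<close>
  have "escape_prob M X = measure (distr M S (steps_seq X)) {x. \<forall>n\<ge>1. partial_sum n x \<noteq> 0}"
    unfolding escape_prob_def
    by (subst measure_distr[OF steps(1)])
       (auto simp: walk_eq_partial_sum vimage_def Int_def conj_commute intro!: pred_eq_sets)
  also have "\<dots> = P.prob (space S - {x. \<exists>n\<ge>1. partial_sum n x = 0})"
    by (auto simp: steps(2) space_S intro!: arg_cong[where f=P.prob])
  also have "\<dots> = 1 - return_prob"
    unfolding return_prob_def by (intro P.prob_compl pred_eq_sets) measurable
  finally have esc: "return_prob = 1 - escape_prob M X" by simp
  have p: "0 < return_prob" "return_prob < 1"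
    using assms(4,5) by (auto simp: esc transient_def)
  have lam: "lambda_star M X = ln (1 / return_prob)"
    by (simp add: lambda_star_def esc)
  have sum: "summable (\<lambda>m. \<bar>f (Suc m)\<bar> * return_prob ^ m)"
    using assms(7)
  proof (elim disjE conjE)
    assume *: "\<forall>i\<ge>1. \<bar>f i\<bar> \<le> C * exp (real i * lambda_star M X) / real i powr (2 + \<epsilon>)"
    show ?thesis
    proof (rule summable_geometric_envelope[OF p(1)])
      show "summable (\<lambda>i. real i powr - (2 + \<epsilon>))"
        using assms(6) by (subst summable_real_powr_iff) simp
      show "\<bar>f i\<bar> \<le> C * exp (real i * ln (1 / return_prob)) * real i powr - (2 + \<epsilon>)" if "i \<ge> 1" for i
        using *[rule_format, OF that] unfolding lam powr_minus divide_inverse .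
    qed
  next
    assume *: "\<forall>i\<ge>2. \<bar>f i\<bar> \<le> C * exp (real i * lambda_star M X) / (real i * ln (real i) powr (2 + \<epsilon>))"
    show ?thesis
    proof (rule summable_geometric_envelope[OF p(1)])
      show "summable (\<lambda>i. 1 / (real i * ln (real i) powr (2 + \<epsilon>)))"
        by (subst summable_iff_shift[of _ 2, symmetric])
           (rule summable_one_over_ln_powr, use assms(6) in simp)
      show "\<bar>f i\<bar> \<le> C * exp (real i * ln (1 / return_prob)) * (1 / (real i * ln (real i) powr (2 + \<epsilon>)))"
        if "i \<ge> 2" for i
        using *[rule_format, OF that] unfolding lam by simp
    qed
  qed
  \<comment> \<open>Telescoping requires the value 0 at 0; the change leaves \<open>G\<close> as it
    is, since only visited sites are summed.\<close>
  define f' where "f' = f(0 := 0)"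
  have G_f': "G X f n \<omega> = G X f' n \<omega>" for n \<omega>
    unfolding G_def by (intro sum.cong) (auto simp: f'_def)
  have "AE x in S. (\<lambda>n. (\<Sum>i\<le>n. f' (visits (n - i) (shift_seq i x)) - f' (visits (n - i) (shift_seq i x) - 1)) / real n)
      \<longlonglongrightarrow> (1 - return_prob)\<^sup>2 * (\<Sum>m. f' (Suc m) * return_prob ^ m)"
    by (rule AE_occupation_average) (use p sum in \<open>simp_all add: f'_def\<close>)
  from AE_distrD[OF steps(1), unfolded steps(2), OF this]
  have "AE \<omega> in M. (\<lambda>n. G X f n \<omega> / real n)
      \<longlonglongrightarrow> (1 - return_prob)\<^sup>2 * (\<Sum>m. f' (Suc m) * return_prob ^ m)"
    by (simp add: G_f' G_eq_sum_visits f'_def)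
  moreover have "summable (\<lambda>j. f (Suc j) * return_prob ^ j)"
    by (rule summable_norm_cancel) (use sum p in \<open>simp add: abs_mult\<close>)
  ultimately show ?thesis
    by (simp add: esc f'_def)
qed

end
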